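(* Let $a,b$ be integers with $a^2+b^2\neq 0$. There is a rational point on the elliptic curve $y^2=x^3+ax+b$ (that is, a pair $(x,y)\in\mathbb{Q}^2$ satisfying this equation) if and only if there exists a positive integer $n$ such that the Diophantine equation $$n y^2=x^3+a n^2 x+b n^3$$ has an integer solution $(x,y)\in\mathbb{Z}^2$.
   Context: The term "elliptic curve" here means the affine curve $y^2=x^3+ax+b$ with $a,b$ integers, not both zero; no nonvanishing of the discriminant is assumed. Rational points are affine points with both coordinates in $\mathbb{Q}$. *)

theory Defs
  imports Complex_Main
begin

end

theory Submission
  imports Defs
begin

text \<open>
  The equation \<open>n y\<^sup>2 = x\<^sup>3 + a n\<^sup>2 x + b n\<^sup>3\<close> is the curve \<open>y\<^sup>2 = x\<^sup>3 + a x + b\<close> after the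
  substitution \<open>(x, y) \<mapsto> (x / n, y / n)\<close> and multiplication by \<open>n\<^sup>3\<close>
  (\<open>fraction_on_curve_iff\<close>). So its integer solutions are exactly the points of the curve
  both of whose coordinates can be written with denominator \<open>n\<close>. As any two rationals have a
  common positive denominator (\<open>rat_common_denominator\<close>), letting \<open>n\<close> vary captures all
  rational points.
\<close>

lemma rat_common_denominator:
  fixes x y :: rat
  obtains n p q :: int
  where "n > 0" "x = of_int p / of_int n" "y = of_int q / of_int n"
proof -
  obtain p d where x: "x = of_int p / of_int d" and "d > 0"
    by (metis Fract_of_int_quotient quotient_of_denom_pos quotient_of_div surj_pair)
  obtain q e where y: "y = of_int q / of_int e" and "e > 0"
    by (metis Fract_of_int_quotient quotient_of_denom_pos quotient_of_div surj_pair)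
  show thesis
  proof (rule that)
    show "d * e > 0" using \<open>d > 0\<close> \<open>e > 0\<close> by simp
    show "x = of_int (p * e) / of_int (d * e)" using x \<open>e > 0\<close> by simp
    show "y = of_int (q * d) / of_int (d * e)" using y \<open>d > 0\<close> by simp
  qed
qed

lemma fraction_on_curve_iff:
  fixes a b n p q :: int
  assumes "n \<noteq> 0"
  shows "(of_int q / of_int n :: rat)\<^sup>2
      = (of_int p / of_int n) ^ 3 + of_int a * (of_int p / of_int n) + of_int b
    \<longleftrightarrow> n * q\<^sup>2 = p ^ 3 + a * n\<^sup>2 * p + b * n ^ 3" (is "?l = ?r \<longleftrightarrow> _")
proof -
  let ?n = "of_int n :: rat"
  have n: "?n \<noteq> 0" using assms by simp
  have l: "?n ^ 3 * ?l = of_int (n * q\<^sup>2)"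
    using n by (simp add: field_simps power2_eq_square power3_eq_cube)
  have r: "?n ^ 3 * ?r = of_int (p ^ 3 + a * n\<^sup>2 * p + b * n ^ 3)"
    using n by (simp add: field_simps power2_eq_square power3_eq_cube)
  have "?l = ?r \<longleftrightarrow> ?n ^ 3 * ?l = ?n ^ 3 * ?r" using n by simp
  then show ?thesis unfolding l r by (simp only: of_int_eq_iff)
qed

theorem theorem1:
  fixes a b :: int
  assumes "a\<^sup>2 + b\<^sup>2 \<noteq> 0"
  shows "(\<exists>x y :: rat. y\<^sup>2 = x ^ 3 + of_int a * x + of_int b) \<longleftrightarrow>
    (\<exists>n :: int. n > 0 \<and>
      (\<exists>x y :: int. n * y\<^sup>2 = x ^ 3 + a * n\<^sup>2 * x + b * n ^ 3))"
proof
  assume "\<exists>x y :: rat. y\<^sup>2 = x ^ 3 + of_int a * x + of_int b"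
  then obtain x y :: rat where xy: "y\<^sup>2 = x ^ 3 + of_int a * x + of_int b" by blast
  obtain n p q where n: "n > 0" and "x = of_int p / of_int n" "y = of_int q / of_int n"
    by (rule rat_common_denominator)
  with xy have "n * q\<^sup>2 = p ^ 3 + a * n\<^sup>2 * p + b * n ^ 3"
    using fraction_on_curve_iff[of n q p a b] by simp
  with n show "\<exists>n :: int. n > 0 \<and> (\<exists>x y :: int. n * y\<^sup>2 = x ^ 3 + a * n\<^sup>2 * x + b * n ^ 3)"
    by blast
next
  assume "\<exists>n :: int. n > 0 \<and> (\<exists>x y :: int. n * y\<^sup>2 = x ^ 3 + a * n\<^sup>2 * x + b * n ^ 3)"
  then obtain n x y :: int
    where "n > 0" "n * y\<^sup>2 = x ^ 3 + a * n\<^sup>2 * x + b * n ^ 3" by blast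
  then show "\<exists>x y :: rat. y\<^sup>2 = x ^ 3 + of_int a * x + of_int b"
    using fraction_on_curve_iff[of n y x a b] by blast
qed

end
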